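(* For all integers $k\ge 0$, there exists an integer $d_0(k)$ such that for all $d\ge d_0(k)$, each partition with deficit $k$ and dinv $d$ appears in exactly one of the sequences $\mathrm{TAIL}(\mu)$ as $\mu$ ranges over the partitions of size $k$.
   Context: A quasi-Dyck vector (QDV) is an integer sequence $v=v_1v_2\cdots v_n$ with $v_1=0$ and $v_{i+1}\le v_i+1$ for all $i<n$. We use word notation; $i^c$ means $c$ copies of $i$; $W^{+}$ adds $1$ to each entry of $W$. Dyck classes $[v]$ are the equivalence classes of the equivalence relation on QDVs generated by $v\sim 0v^+$. An integer partition $\lambda$ (with $\ell(\lambda)$ positive parts and $\lambda_i=0$ for $i>\ell(\lambda)$; the zero partition $\langle 0\rangle$ is allowed) is identified with the Dyck class consisting of all QDVs $\mathrm{QDV}_n(\lambda)=(0-\lambda_n,1-\lambda_{n-1},\ldots,n-1-\lambda_1)$, $n>\ell(\lambda)$; this is a bijection between partitions and Dyck classes. For a QDV $v$ of length $n$: $\mathrm{area}(v)=v_1+\cdots+v_n$; $\mathrm{dinv}(v)$ is the number of pairs of integers $i<j\le n$ with $v_i-v_j\in\{0,1\}$, where $v_k=k-1$ for all $k\le 0$; the deficit is $\mathrm{defc}(v)=\binom{n}{2}-\mathrm{area}(v)-\mathrm{dinv}(v)$. Both dinv and defc are constant on Dyck classes, hence defined for partitions (and $|\lambda|=\mathrm{dinv}(\lambda)+\mathrm{defc}(\lambda)$). The map $\mathrm{NU}_1$ is defined on partitions $\gamma$ with $\gamma_1\le \ell(\gamma)+2$ by $\mathrm{NU}_1(\gamma)=\langle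 \ell+1,\gamma_1-1,\ldots,\gamma_\ell-1\rangle$, $\ell=\ell(\gamma)$ (zero parts dropped). For nonzero $\mu=\langle r^{n_r}\cdots 2^{n_2}1^{n_1}\rangle$ with $n_r>0$ ($n_i$ is the number of parts equal to $i$), $B_\mu=01^{n_1}01^{n_2}\cdots 01^{n_r}$; $B_{\langle 0\rangle}$ is the empty word. $\mathrm{TI}(\mu)=[0B_\mu]$, and $\mathrm{TAIL}(\mu)$ is the sequence of Dyck classes (partitions) reachable from $\mathrm{TI}(\mu)$ by applying $\mathrm{NU}_1$ zero or more times. *)

theory Defs
  imports Complex_Main
begin

definition QDV :: "int list \<Rightarrow> bool" where
  "QDV v \<longleftrightarrow> v \<noteq> [] \<and> v ! 0 = 0 \<and> (\<forall>i. Suc i < length v \<longrightarrow> v ! Suc i \<le> v ! i + 1)"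

definition dyck_step :: "int list \<Rightarrow> int list \<Rightarrow> bool" where
  "dyck_step v w \<longleftrightarrow> QDV v \<and> w = 0 # map (\<lambda>x. x + 1) v"

text \<open>Since \<open>0v\<^sup>+\<close> is again a QDV, the class of a QDV consists of QDVs only.\<close>

definition dyck_class :: "int list \<Rightarrow> int list set" where
  "dyck_class v = {w. equivclp dyck_step v w}"

text \<open>An integer partition is the weakly decreasing list of its positive parts; \<open>[]\<close> is the
  zero partition.\<close>

definition is_partition :: "nat list \<Rightarrow> bool" where
  "is_partition \<gamma> \<longleftrightarrow> sorted_wrt (\<ge>) \<gamma> \<and> 0 \<notin> set \<gamma>"

text \<open>Parts are numbered from 1 and are 0 beyond the length.\<close>

definition part :: "nat list \<Rightarrow> nat \<Rightarrow> nat" where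
  "part \<gamma> i = (if 1 \<le> i \<and> i \<le> length \<gamma> then \<gamma> ! (i - 1) else 0)"

definition qdv_of_partition :: "nat \<Rightarrow> nat list \<Rightarrow> int list" where
  "qdv_of_partition n \<gamma> = map (\<lambda>i. int i - int (part \<gamma> (n - i))) [0..<n]"

definition class_of_partition :: "nat list \<Rightarrow> int list set" where
  "class_of_partition \<gamma> = {qdv_of_partition n \<gamma> | n. length \<gamma> < n}"

definition partition_of_class :: "int list set \<Rightarrow> nat list" where
  "partition_of_class C = (THE \<gamma>. is_partition \<gamma> \<and> class_of_partition \<gamma> = C)"

text \<open>Entries of a QDV are numbered from 1, extended to all indices \<open>k \<le> 0\<close> by \<open>k - 1\<close>.\<close>

definition entry :: "int list \<Rightarrow> int \<Rightarrow> int" where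
  "entry v k = (if k \<le> 0 then k - 1 else v ! nat (k - 1))"

definition area_qdv :: "int list \<Rightarrow> int" where
  "area_qdv v = sum_list v"

text \<open>The set of pairs below is finite: there is no pair with \<open>j \<le> 0\<close>, and for given \<open>j\<close> the
  condition leaves at most two indices \<open>i \<le> 0\<close>.\<close>

definition dinv_qdv :: "int list \<Rightarrow> int" where
  "dinv_qdv v =
     int (card {(i, j). i < j \<and> j \<le> int (length v) \<and> entry v i - entry v j \<in> {0, 1}})"

definition defc_qdv :: "int list \<Rightarrow> int" where
  "defc_qdv v = int (length v choose 2) - area_qdv v - dinv_qdv v"

text \<open>Both statistics are constant on Dyck classes, so the images below are singletons.\<close>

definition dinv :: "nat list \<Rightarrow> int" where
  "dinv \<gamma> = the_elem (dinv_qdv ` class_of_partition \<gamma>)"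

definition defc :: "nat list \<Rightarrow> int" where
  "defc \<gamma> = the_elem (defc_qdv ` class_of_partition \<gamma>)"

definition NU1_dom :: "nat list \<Rightarrow> bool" where
  "NU1_dom \<gamma> \<longleftrightarrow> is_partition \<gamma> \<and> part \<gamma> 1 \<le> length \<gamma> + 2"

definition NU1 :: "nat list \<Rightarrow> nat list" where
  "NU1 \<gamma> = (length \<gamma> + 1) # filter (\<lambda>p. p > 0) (map (\<lambda>p. p - 1) \<gamma>)"

text \<open>For nonzero \<open>\<mu>\<close> the first part is the largest part \<open>r\<close>; for the zero partition the
  index list is empty.\<close>

definition B :: "nat list \<Rightarrow> int list" where
  "B \<mu> = concat (map (\<lambda>i. 0 # replicate (count_list \<mu> i) 1) [1..<Suc (part \<mu> 1)])"

definition TI :: "nat list \<Rightarrow> nat list" where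
  "TI \<mu> = partition_of_class (dyck_class (0 # B \<mu>))"

text \<open>The set of terms of the sequence, which ends when it leaves the domain of \<open>NU1\<close>.\<close>

inductive_set TAIL :: "nat list \<Rightarrow> nat list set" for \<mu> where
  initial: "TI \<mu> \<in> TAIL \<mu>"
| next_term: "\<gamma> \<in> TAIL \<mu> \<Longrightarrow> NU1_dom \<gamma> \<Longrightarrow> NU1 \<gamma> \<in> TAIL \<mu>"

end

theory Submission
  imports Defs
begin

text \<open>
  Removing the first column and adding a new first row, \<open>NU1\<close> is injective on its domain, and a
  nonzero partition \<open>\<gamma>\<close> is outside its image exactly if \<open>\<gamma>\<^sub>1 < \<ell>(\<gamma>)\<close>. Hence every partition lies
  on a unique chain that begins at such a starting point. On QDVs, \<open>NU1\<close> is \<open>0w \<mapsto> 0w\<^sup>+0\<close>, which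
  preserves the deficit. A starting point has a QDV \<open>0w\<close> with \<open>w\<^sub>1 \<le> 0\<close> and last entry positive;
  every positive entry costs at least one unit of deficit, and this bounds the length, so there are
  finitely many starting points of deficit \<open>k\<close>. Beyond the finite chains among theirs, only
  infinite chains remain, and it suffices to show that these start exactly at \<open>TI(\<mu>)\<close> with
  \<open>|\<mu>| = k\<close>.

  Record \<open>\<gamma>\<close> by the multiplicities of \<open>1, \<dots>, \<ell>+2\<close> in \<open>\<gamma>\<close> together with the extra part \<open>\<ell>+2\<close>.
  Then \<open>NU1\<close> rotates this word of tokens: a leading \<open>0\<close> is moved to the end as \<open>01\<close>, a leading \<open>1\<close>
  as \<open>1\<close>, a leading \<open>2\<close> is absorbed into the last token, and a leading token above \<open>2\<close> ends the
  chain. Two tokens \<open>2\<close> separated only by \<open>1\<close>s approach each other on every pass and finally merge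
  into a \<open>3\<close>. On an infinite chain this cannot happen, so every factor of the word has sum at most
  its length plus one. For a starting point the word is \<open>V001\<close>, where \<open>V\<close> has sum exactly its
  length plus one; therefore every prefix of \<open>V\<close> has excess \<open>0\<close> or \<open>1\<close>, which says that the QDV is
  \<open>0w\<close> with \<open>w\<close> a \<open>0\<close>-\<open>1\<close> word. Such a word, starting with \<open>0\<close> and ending with \<open>1\<close>, is \<open>B\<^sub>\<mu>\<close> for the
  partition \<open>\<mu>\<close> that lists, for each \<open>1\<close>, the number of \<open>0\<close>s before it.
\<close>

section \<open>Recursion for dinv and the deficit\<close>

text \<open>The number of entries at indices \<open>\<le> 0\<close> that are equal to \<open>x\<close> or \<open>x + 1\<close>.\<close>

definition ramp_pairs :: "int \<Rightarrow> int" where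
  "ramp_pairs x = (if x \<le> -2 then 2 else if x = -1 then 1 else 0)"

definition dinv_pairs :: "int list \<Rightarrow> (int \<times> int) set" where
  "dinv_pairs v = {(i, j). i < j \<and> j \<le> int (length v) \<and> entry v i - entry v j \<in> {0, 1}}"

lemma entry_append: "k \<le> int (length xs) \<Longrightarrow> entry (xs @ ys) k = entry xs k"
  by (auto simp: entry_def nth_append)

lemma dinv_pairs_Nil: "dinv_pairs [] = {}"
  by (auto simp: dinv_pairs_def entry_def)

lemma card_ramp: "int (card {i::int. i \<le> 0 \<and> i - 1 \<in> {x, x + 1}}) = ramp_pairs x"
  and finite_ramp: "finite {i::int. i \<le> 0 \<and> i - 1 \<in> {x, x + 1}}"
proof -
  have *: "{i::int. i \<le> 0 \<and> i - 1 \<in> {x, x + 1}} =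
     (if x \<le> -2 then {x + 1, x + 2} else if x = -1 then {0} else {})"
    by auto
  show "int (card {i::int. i \<le> 0 \<and> i - 1 \<in> {x, x + 1}}) = ramp_pairs x"
    unfolding * by (simp add: ramp_pairs_def)
  show "finite {i::int. i \<le> 0 \<and> i - 1 \<in> {x, x + 1}}"
    unfolding * by simp
qed

lemma length_filter_pair:
  "length (filter (\<lambda>y. y \<in> {x, x + 1}) xs) = count_list xs x + count_list xs (x + 1)" for x :: int
  by (induction xs) auto

text \<open>Appending an entry keeps all earlier pairs; the new ones end at the last index, and
  their left partners lie on the ramp of indices at most 0 or in \<open>xs\<close>. Finiteness is
  carried along because \<open>card\<close> of an infinite set would be 0.\<close>

lemma dinv_pairs_snoc:
  "finite (dinv_pairs xs) \<Longrightarrow>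
   finite (dinv_pairs (xs @ [x])) \<and>
   int (card (dinv_pairs (xs @ [x]))) =
     int (card (dinv_pairs xs)) + int (count_list xs x) + int (count_list xs (x + 1)) + ramp_pairs x"
proof -
  assume fin: "finite (dinv_pairs xs)"
  define n where "n = int (length xs)"
  define T0 where "T0 = {i::int. i \<le> 0 \<and> i - 1 \<in> {x, x + 1}}"
  define M where "M = {m. m < length xs \<and> xs ! m \<in> {x, x + 1}}"
  define T1 where "T1 = (\<lambda>m. int m + 1) ` M"
  define T where "T = (\<lambda>i. (i, n + 1)) ` (T0 \<union> T1)"
  have last: "entry (xs @ [x]) (n + 1) = x"
    by (simp add: entry_def n_def nth_append)
  have mem1: "i \<in> T0 \<union> T1 \<longleftrightarrow> i \<le> n \<and> entry xs i \<in> {x, x + 1}" for i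
  proof (cases "i \<le> 0")
    case True
    then show ?thesis by (auto simp: T0_def T1_def entry_def n_def)
  next
    case False
    have "i \<in> T1 \<longleftrightarrow> i \<le> n \<and> entry xs i \<in> {x, x + 1}"
    proof
      assume "i \<in> T1"
      then show "i \<le> n \<and> entry xs i \<in> {x, x + 1}"
        by (auto simp: T1_def M_def entry_def n_def)
    next
      assume a: "i \<le> n \<and> entry xs i \<in> {x, x + 1}"
      then have "nat (i - 1) \<in> M" using False by (auto simp: M_def entry_def n_def)
      moreover have "i = int (nat (i - 1)) + 1" using False by simp
      ultimately show "i \<in> T1" unfolding T1_def by blast
    qed
    then show ?thesis using False by (auto simp: T0_def)
  qed
  have eq: "dinv_pairs (xs @ [x]) = dinv_pairs xs \<union> T"
  proof (rule set_eqI, clarify)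
    fix i j
    show "((i, j) \<in> dinv_pairs (xs @ [x])) = ((i, j) \<in> dinv_pairs xs \<union> T)"
    proof (cases "j = n + 1")
      case True
      have "(i, j) \<notin> dinv_pairs xs" using True by (simp add: dinv_pairs_def n_def)
      moreover have "(i, j) \<in> dinv_pairs (xs @ [x]) \<longleftrightarrow> i \<le> n \<and> entry xs i \<in> {x, x + 1}"
        using True last by (auto simp: dinv_pairs_def n_def entry_append)
      moreover have "(i, j) \<in> T \<longleftrightarrow> i \<in> T0 \<union> T1" using True by (auto simp: T_def)
      ultimately show ?thesis using mem1 by blast
    next
      case False
      then show ?thesis by (auto simp: dinv_pairs_def n_def entry_append T_def)
    qed
  qed
  have disj: "dinv_pairs xs \<inter> T = {}"
    by (auto simp: dinv_pairs_def T_def n_def)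
  have finT: "finite T0" "finite T1" "finite T"
    using finite_ramp[of x] by (auto simp: T_def T0_def T1_def M_def)
  have "card T = card (T0 \<union> T1)"
    unfolding T_def by (rule card_image) (auto simp: inj_on_def)
  also have "\<dots> = card T0 + card T1"
    by (rule card_Un_disjoint) (use finT in \<open>auto simp: T0_def T1_def\<close>)
  also have "card T1 = card M"
    unfolding T1_def by (rule card_image) (auto simp: inj_on_def)
  also have "card M = count_list xs x + count_list xs (x + 1)"
    unfolding M_def length_filter_pair[symmetric] by (rule length_filter_conv_card[symmetric])
  finally have "int (card T) = ramp_pairs x + int (count_list xs x) + int (count_list xs (x + 1))"
    using card_ramp[of x] by (simp add: T0_def)
  then show ?thesis
    using fin finT disj unfolding eq by (simp add: card_Un_disjoint)
qed

lemma dinv_qdv_eq: "dinv_qdv v = int (card (dinv_pairs v))"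
  by (simp only: dinv_qdv_def dinv_pairs_def)

lemma dinv_qdv_Nil [simp]: "dinv_qdv [] = 0"
  by (simp add: dinv_qdv_eq dinv_pairs_Nil)

lemma dinv_qdv_snoc:
  "dinv_qdv (xs @ [x]) =
     dinv_qdv xs + int (count_list xs x) + int (count_list xs (x + 1)) + ramp_pairs x"
proof -
  have "finite (dinv_pairs xs)"
    by (induction xs rule: rev_induct) (auto simp: dinv_pairs_Nil dest: dinv_pairs_snoc)
  from dinv_pairs_snoc[OF this] show ?thesis
    by (simp add: dinv_qdv_eq)
qed

section \<open>Effect of shift and rotation on dinv and the deficit\<close>

lemma count_list_map_succ: "count_list (map (\<lambda>x. x + 1) xs) y = count_list xs (y - 1)" for y :: int
  by (induction xs) auto

text \<open>The new leading 0 is the ramp entry at index 0 raised by one, so the two extended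
  sequences agree up to reindexing and adding 1. In the induction this appears as a change in
  \<open>ramp_pairs\<close> that the count of the new 0 compensates.\<close>

lemma dinv_qdv_shift: "dinv_qdv (0 # map (\<lambda>x. x + 1) v) = dinv_qdv v"
proof (induction v rule: rev_induct)
  case Nil
  show ?case using dinv_qdv_snoc[of "[]" 0] by (simp add: ramp_pairs_def)
next
  case (snoc x v)
  have "count_list (0 # map (\<lambda>x. x + 1) v) y = count_list v (y - 1) + (if y = 0 then 1 else 0)" for y
    by (simp add: count_list_map_succ)
  then show ?case
    using dinv_qdv_snoc[of "0 # map (\<lambda>x. x + 1) v" "x + 1"] dinv_qdv_snoc[of v x] snoc
    by (simp add: ramp_pairs_def add.commute del: count_list.simps split: if_splits)
qed

text \<open>Inserting a 0 after the ramp leaves the ramp pairs of each entry of \<open>w\<close>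
  unchanged, as they depend only on its value. The 0 itself pairs only with later entries 0 and
  -1.\<close>

lemma dinv_qdv_Cons_0:
  "dinv_qdv (0 # w) = dinv_qdv w + int (count_list w 0) + int (count_list w (- 1))"
proof (induction w rule: rev_induct)
  case Nil
  show ?case using dinv_qdv_snoc[of "[]" 0] by (simp add: ramp_pairs_def)
next
  case (snoc x w)
  show ?case
    using dinv_qdv_snoc[of "0 # w" x] dinv_qdv_snoc[of w x] snoc
    by auto
qed

text \<open>The final 0 pairs with the images of the entries -1 and 0 of \<open>w\<close>, exactly
  those that paired with the leading 0 before, and in addition with the new leading 0.\<close>

lemma dinv_qdv_rotate:
  "dinv_qdv (0 # map (\<lambda>x. x + 1) w @ [0]) = dinv_qdv (0 # w) + 1"
proof -
  have "count_list (0 # map (\<lambda>x. x + 1) w) 0 = Suc (count_list w (- 1))"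
    "count_list (0 # map (\<lambda>x. x + 1) w) (0 + 1) = count_list w 0"
    by (simp_all add: count_list_map_succ)
  then show ?thesis
    using dinv_qdv_snoc[of "0 # map (\<lambda>x. x + 1) w" 0] dinv_qdv_shift[of w] dinv_qdv_Cons_0[of w]
    by (simp add: ramp_pairs_def del: count_list.simps)
qed

lemma sum_list_map_succ: "sum_list (map (\<lambda>x. x + 1) v) = sum_list v + int (length v)" for v :: "int list"
  by (induction v) auto

lemma int_Suc_choose_2: "int (Suc n choose 2) = int (n choose 2) + int n"
  by (simp add: numeral_2_eq_2)

lemma defc_qdv_shift: "defc_qdv (0 # map (\<lambda>x. x + 1) v) = defc_qdv v"
  by (simp add: defc_qdv_def dinv_qdv_shift area_qdv_def sum_list_map_succ int_Suc_choose_2)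

text \<open>The binomial coefficient grows by \<open>length w + 1\<close>, the area by
  \<open>length w\<close> and dinv by 1.\<close>

lemma defc_qdv_rotate: "defc_qdv (0 # map (\<lambda>x. x + 1) w @ [0]) = defc_qdv (0 # w)"
  using int_Suc_choose_2[of "Suc (length w)"]
  by (simp add: defc_qdv_def dinv_qdv_rotate area_qdv_def sum_list_map_succ)

lemma defc_qdv_snoc:
  "defc_qdv (xs @ [x]) = defc_qdv xs + int (length xs) - x
     - int (count_list xs x) - int (count_list xs (x + 1)) - ramp_pairs x"
  by (simp add: defc_qdv_def dinv_qdv_snoc area_qdv_def int_Suc_choose_2)

lemma defc_qdv_Nil: "defc_qdv [] = 0"
  by (simp add: defc_qdv_def area_qdv_def)

lemma defc_qdv_0: "defc_qdv [0] = 0"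
  using defc_qdv_snoc[of "[]" 0] by (simp add: defc_qdv_Nil ramp_pairs_def)

section \<open>Partitions and Dyck classes\<close>

lemma part_beyond: "length \<gamma> < i \<Longrightarrow> part \<gamma> i = 0"
  by (simp add: part_def)

lemma part_Suc: "i < length \<gamma> \<Longrightarrow> part \<gamma> (Suc i) = \<gamma> ! i"
  by (simp add: part_def)

lemma part_pos: "is_partition \<gamma> \<Longrightarrow> 1 \<le> i \<Longrightarrow> i \<le> length \<gamma> \<Longrightarrow> part \<gamma> i > 0"
  by (auto simp: is_partition_def part_def intro!: gr0I)
    (metis Suc_diff_1 Suc_le_lessD nth_mem Suc_le_eq One_nat_def)

lemma part_antimono:
  assumes "is_partition \<gamma>" "1 \<le> i" "i \<le> j"
  shows "part \<gamma> j \<le> part \<gamma> i"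
proof (cases "i = j \<or> length \<gamma> < j")
  case True
  then show ?thesis by (auto simp: part_beyond)
next
  case False
  then have "i - 1 < j - 1" "j - 1 < length \<gamma>" using assms by auto
  then have "\<gamma> ! (j - 1) \<le> \<gamma> ! (i - 1)"
    using assms(1) by (auto simp: is_partition_def sorted_wrt_iff_nth_less)
  then show ?thesis using False assms by (simp add: part_def)
qed

lemma partition_eqI:
  assumes "is_partition \<gamma>" "is_partition \<delta>" "\<And>i. 1 \<le> i \<Longrightarrow> part \<gamma> i = part \<delta> i"
  shows "\<gamma> = \<delta>"
proof (rule nth_equalityI)
  have "length \<gamma> \<le> length \<delta>" if "is_partition \<gamma>" "\<And>i. 1 \<le> i \<Longrightarrow> part \<gamma> i = part \<delta> i" for \<gamma> \<delta>
    using that part_pos[OF that(1), of "length \<gamma>"] part_beyond[of \<delta> "length \<gamma>"]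
    by (cases "length \<gamma>") force+
  from this[of \<gamma> \<delta>] this[of \<delta> \<gamma>] show len: "length \<gamma> = length \<delta>"
    using assms by force
  show "\<gamma> ! i = \<delta> ! i" if "i < length \<gamma>" for i
    using assms(3)[of "Suc i"] that len by (simp add: part_Suc)
qed

lemma length_qdv [simp]: "length (qdv_of_partition n \<gamma>) = n"
  by (simp add: qdv_of_partition_def)

lemma nth_qdv [simp]: "i < n \<Longrightarrow> qdv_of_partition n \<gamma> ! i = int i - int (part \<gamma> (n - i))"
  by (simp add: qdv_of_partition_def)

lemma QDV_qdv:
  assumes "is_partition \<gamma>" "length \<gamma> < n"
  shows "QDV (qdv_of_partition n \<gamma>)"
proof -
  have "part \<gamma> (n - i) \<le> part \<gamma> (n - Suc i)" if "Suc i < n" for i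
    using that by (intro part_antimono[OF assms(1)]) auto
  moreover have "qdv_of_partition n \<gamma> \<noteq> []" using assms(2) by (metis length_qdv list.size(3) not_less_zero)
  ultimately show ?thesis using assms(2) by (simp add: QDV_def part_beyond)
qed

lemma qdv_Suc:
  assumes "length \<gamma> < n"
  shows "qdv_of_partition (Suc n) \<gamma> = 0 # map (\<lambda>x. x + 1) (qdv_of_partition n \<gamma>)"
proof (rule nth_equalityI)
  fix i assume "i < length (qdv_of_partition (Suc n) \<gamma>)"
  then show "qdv_of_partition (Suc n) \<gamma> ! i = (0 # map (\<lambda>x. x + 1) (qdv_of_partition n \<gamma>)) ! i"
    using assms by (cases i) (auto simp: part_beyond)
qed simp

lemma qdv_inj:
  assumes "is_partition \<gamma>" "is_partition \<delta>" "length \<gamma> < n" "length \<delta> < n"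
    "qdv_of_partition n \<gamma> = qdv_of_partition n \<delta>"
  shows "\<gamma> = \<delta>"
proof (rule partition_eqI[OF assms(1,2)])
  fix i :: nat assume "1 \<le> i"
  show "part \<gamma> i = part \<delta> i"
  proof (cases "i \<le> n")
    case True
    then show ?thesis
      using arg_cong[OF assms(5), of "\<lambda>v. v ! (n - i)"] \<open>1 \<le> i\<close> by simp
  next
    case False
    then show ?thesis using assms(3,4) by (simp add: part_beyond)
  qed
qed

lemma class_of_partition_inj:
  assumes "is_partition \<gamma>" "is_partition \<delta>" "class_of_partition \<gamma> = class_of_partition \<delta>"
  shows "\<gamma> = \<delta>"
proof -
  define n where "n = Suc (length \<gamma> + length \<delta>)"
  have "qdv_of_partition n \<gamma> \<in> class_of_partition \<gamma>"
    unfolding class_of_partition_def n_def by auto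
  then obtain m where m: "qdv_of_partition n \<gamma> = qdv_of_partition m \<delta>"
    unfolding assms(3) unfolding class_of_partition_def by blast
  then have "m = n" by (metis length_qdv)
  with m show ?thesis by (intro qdv_inj[OF assms(1,2), of n]) (auto simp: n_def)
qed

text \<open>A generating step only changes the length of the representative of \<gamma>. The point
  to check is that a backward step cannot go below length
  \<open>length \<gamma> + 1\<close>.\<close>

lemma dyck_class_qdv:
  assumes "is_partition \<gamma>" "length \<gamma> < n"
  shows "dyck_class (qdv_of_partition n \<gamma>) = class_of_partition \<gamma>"
proof
  have step: "dyck_step (qdv_of_partition m \<gamma>) (qdv_of_partition (Suc m) \<gamma>)" if "length \<gamma> < m" for m
    using that QDV_qdv[OF assms(1) that] by (simp add: dyck_step_def qdv_Suc)
  have up: "equivclp dyck_step (qdv_of_partition m \<gamma>) (qdv_of_partition (m + d) \<gamma>)" if "length \<gamma> < m" for m d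
  proof (induction d)
    case (Suc d)
    then show ?case using step[of "m + d"] that
      by (auto intro: equivclp_into_equivclp)
  qed auto
  show "class_of_partition \<gamma> \<subseteq> dyck_class (qdv_of_partition n \<gamma>)"
  proof
    fix v assume "v \<in> class_of_partition \<gamma>"
    then obtain m where m: "v = qdv_of_partition m \<gamma>" "length \<gamma> < m"
      unfolding class_of_partition_def by auto
    have "equivclp dyck_step (qdv_of_partition n \<gamma>) v"
    proof (cases "n \<le> m")
      case True
      then show ?thesis using up[OF assms(2), of "m - n"] m by simp
    next
      case False
      then show ?thesis using up[OF m(2), of "n - m"] m equivclp_sym by fastforce
    qed
    then show "v \<in> dyck_class (qdv_of_partition n \<gamma>)" by (simp add: dyck_class_def)
  qed
  show "dyck_class (qdv_of_partition n \<gamma>) \<subseteq> class_of_partition \<gamma>"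
  proof
    fix v assume "v \<in> dyck_class (qdv_of_partition n \<gamma>)"
    then have "equivclp dyck_step (qdv_of_partition n \<gamma>) v" by (simp add: dyck_class_def)
    then show "v \<in> class_of_partition \<gamma>"
    proof (induction rule: equivclp_induct)
      case base
      then show ?case using assms(2) by (auto simp: class_of_partition_def)
    next
      case (step y z)
      then obtain m where m: "y = qdv_of_partition m \<gamma>" "length \<gamma> < m"
        unfolding class_of_partition_def by auto
      from step(2) show ?case
      proof
        assume "dyck_step y z"
        then have "z = qdv_of_partition (Suc m) \<gamma>" using m by (simp add: dyck_step_def qdv_Suc)
        then show ?thesis using m by (auto simp: class_of_partition_def)
      next
        assume "dyck_step z y"
        then have z: "QDV z" and y: "y = 0 # map (\<lambda>x. x + 1) z" by (auto simp: dyck_step_def)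
        have mz: "m = Suc (length z)" using y m by (metis length_Cons length_map length_qdv)
        \<comment> \<open>As \<open>z\<close> starts with 0, the second entry of \<open>y\<close> is
          1. By the formula for the QDV this entry is 1 minus the part with number
          \<open>m - 1\<close>, so that part is 0 and the shortened word is still long
          enough.\<close>
        have "y ! 1 = 1" using z y by (auto simp: QDV_def)
        moreover have z0: "length z > 0" using z by (auto simp: QDV_def)
        ultimately have "part \<gamma> (length z) = 0" using m mz by simp
        then have "length \<gamma> < length z" using part_pos[OF assms(1), of "length z"] z0 by linarith
        moreover from this have "z = qdv_of_partition (length z) \<gamma>"
          using y m(1) qdv_Suc[of \<gamma> "length z"] mz by (auto simp: inj_def)
        ultimately show ?thesis unfolding class_of_partition_def by blast
      qed
    qed
  qed
qed

lemma partition_of_class_dyck_class: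
  assumes "is_partition \<gamma>" "length \<gamma> < n"
  shows "partition_of_class (dyck_class (qdv_of_partition n \<gamma>)) = \<gamma>"
  unfolding partition_of_class_def dyck_class_qdv[OF assms]
  by (rule the_equality) (use assms(1) class_of_partition_inj in \<open>auto intro: class_of_partition_inj\<close>)

lemma defc_qdv_of_partition:
  assumes "length \<gamma> < n"
  shows "defc_qdv (qdv_of_partition n \<gamma>) = defc \<gamma>"
proof -
  have "defc_qdv (qdv_of_partition (Suc (length \<gamma>) + m) \<gamma>) =
    defc_qdv (qdv_of_partition (Suc (length \<gamma>)) \<gamma>)" for m
    by (induction m) (auto simp: qdv_Suc defc_qdv_shift)
  then have *: "defc_qdv (qdv_of_partition m \<gamma>) = defc_qdv (qdv_of_partition (Suc (length \<gamma>)) \<gamma>)"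
    if "length \<gamma> < m" for m
    using that by (metis Suc_leI le_add_diff_inverse)
  have "defc_qdv v = defc_qdv (qdv_of_partition n \<gamma>)" if v: "v \<in> class_of_partition \<gamma>" for v
  proof -
    obtain m where "v = qdv_of_partition m \<gamma>" "length \<gamma> < m"
      using v unfolding class_of_partition_def by blast
    then show ?thesis using *[OF assms] *[of m] by metis
  qed
  moreover have "qdv_of_partition n \<gamma> \<in> class_of_partition \<gamma>"
    using assms unfolding class_of_partition_def by blast
  ultimately have "defc_qdv ` class_of_partition \<gamma> = {defc_qdv (qdv_of_partition n \<gamma>)}"
    by blast
  then show ?thesis by (simp add: defc_def)
qed

section \<open>The map \<open>NU1\<close>\<close>

lemma is_partition_Nil [simp]: "is_partition []"
  by (simp add: is_partition_def)

lemma is_partition_Cons: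
  "is_partition (a # \<gamma>) \<longleftrightarrow> 0 < a \<and> (\<forall>b\<in>set \<gamma>. b \<le> a) \<and> is_partition \<gamma>"
  by (auto simp: is_partition_def)

lemma part_Cons: "part (a # \<gamma>) i = (if i = 0 then 0 else if i = 1 then a else part \<gamma> (i - 1))"
  by (auto simp: part_def nth_Cons')

lemma part_1: "part \<gamma> 1 = (if \<gamma> = [] then 0 else hd \<gamma>)"
  by (cases \<gamma>) (auto simp: part_def)

definition drop_column :: "nat list \<Rightarrow> nat list" where
  "drop_column \<gamma> = filter (\<lambda>p. p > 0) (map (\<lambda>p. p - 1) \<gamma>)"

lemma drop_column_simps [simp]:
  "drop_column [] = []"
  "drop_column (a # \<gamma>) = (if 1 < a then [a - 1] else []) @ drop_column \<gamma>"
  by (auto simp: drop_column_def)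

lemma NU1_eq: "NU1 \<gamma> = (length \<gamma> + 1) # drop_column \<gamma>"
  by (simp add: NU1_def drop_column_def)

lemma drop_column_ones: "\<forall>b\<in>set \<gamma>. b \<le> 1 \<Longrightarrow> drop_column \<gamma> = []"
  by (induction \<gamma>) auto

lemma part_drop_column:
  "is_partition \<gamma> \<Longrightarrow> part (drop_column \<gamma>) i = part \<gamma> i - 1"
proof (induction \<gamma> arbitrary: i)
  case Nil
  then show ?case by (simp add: part_def)
next
  case (Cons a \<gamma>)
  show ?case
  proof (cases "1 < a")
    case True
    then show ?thesis using Cons by (auto simp: part_Cons is_partition_Cons)
  next
    case False
    then have "drop_column (a # \<gamma>) = []" using Cons.prems
      by (intro drop_column_ones) (auto simp: is_partition_Cons)
    moreover have "part (a # \<gamma>) i \<le> 1"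
    proof (cases "i = 0")
      case True
      then show ?thesis by (simp add: part_def)
    next
      case i: False
      have "part (a # \<gamma>) i \<le> part (a # \<gamma>) 1"
        using i by (intro part_antimono[OF Cons.prems]) auto
      then show ?thesis using False by (simp add: part_Cons)
    qed
    ultimately show ?thesis by (simp add: part_def)
  qed
qed

lemma set_drop_column: "set (drop_column \<gamma>) = (\<lambda>p. p - 1) ` {p \<in> set \<gamma>. 1 < p}"
  by (induction \<gamma>) auto

lemma is_partition_drop_column: "is_partition \<gamma> \<Longrightarrow> is_partition (drop_column \<gamma>)"
  by (induction \<gamma>) (auto simp: is_partition_Cons set_drop_column intro: diff_le_mono)

lemma length_drop_column:
  "is_partition \<gamma> \<Longrightarrow> length (drop_column \<gamma>) + count_list \<gamma> 1 = length \<gamma>"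
  by (induction \<gamma>) (auto simp: is_partition_Cons)

lemma count_drop_column: "0 < x \<Longrightarrow> count_list (drop_column \<gamma>) x = count_list \<gamma> (Suc x)"
  by (induction \<gamma>) auto

lemma le_part_1: "is_partition \<gamma> \<Longrightarrow> p \<in> set \<gamma> \<Longrightarrow> p \<le> part \<gamma> 1"
  by (cases \<gamma>) (auto simp: is_partition_Cons part_Cons)

lemma is_partition_NU1: "NU1_dom \<gamma> \<Longrightarrow> is_partition (NU1 \<gamma>)"
  using le_part_1[of \<gamma>]
  by (force simp: NU1_dom_def NU1_eq is_partition_Cons is_partition_drop_column set_drop_column)

text \<open>Only parts equal to 1 vanish; they stand at the end, and the lost length tells their
  number. Since \<open>NU1\<close> records the old length in its first part, it can be
  undone.\<close>

lemma drop_column_inverse: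
  "is_partition \<gamma> \<Longrightarrow>
   \<gamma> = map Suc (drop_column \<gamma>) @ replicate (length \<gamma> - length (drop_column \<gamma>)) 1"
proof (induction \<gamma>)
  case (Cons a \<gamma>)
  show ?case
  proof (cases "1 < a")
    case True
    then show ?thesis using Cons by (simp add: is_partition_Cons)
  next
    case False
    then have "\<forall>b\<in>set (a # \<gamma>). b \<le> 1" "0 \<notin> set (a # \<gamma>)" using Cons.prems
      by (auto simp: is_partition_Cons is_partition_def)
    then have "\<forall>b\<in>set (a # \<gamma>). b = 1" by (metis One_nat_def le_SucE le_zero_eq)
    moreover from this have "drop_column (a # \<gamma>) = []" by (intro drop_column_ones) auto
    ultimately show ?thesis
      by (metis append_Nil diff_zero list.map(1) list.size(3) replicate_length_same)
  qed
qed simp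

lemma NU1_inj:
  assumes "is_partition \<gamma>" "is_partition \<delta>" "NU1 \<gamma> = NU1 \<delta>"
  shows "\<gamma> = \<delta>"
  using assms drop_column_inverse[of \<gamma>] drop_column_inverse[of \<delta>] by (simp add: NU1_eq)

text \<open>Removing the column raises every entry after the first by one, and the new first part,
  one more than the length of \<gamma>, produces the final 0.\<close>

lemma qdv_NU1:
  assumes "is_partition \<gamma>"
  shows "qdv_of_partition (length \<gamma> + 2) (NU1 \<gamma>) =
    0 # map (\<lambda>x. x + 1) (tl (qdv_of_partition (length \<gamma> + 1) \<gamma>)) @ [0]"
proof (rule nth_equalityI)
  fix i assume "i < length (qdv_of_partition (length \<gamma> + 2) (NU1 \<gamma>))"
  then have i: "i < length \<gamma> + 2" by simp
  have len: "length (drop_column \<gamma>) \<le> length \<gamma>" using length_drop_column[OF assms] by simp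
  consider "i = 0" | "i = Suc (length \<gamma>)" | "0 < i" "i \<le> length \<gamma>" using i by linarith
  then show "qdv_of_partition (length \<gamma> + 2) (NU1 \<gamma>) ! i =
    (0 # map (\<lambda>x. x + 1) (tl (qdv_of_partition (length \<gamma> + 1) \<gamma>)) @ [0]) ! i"
  proof cases
    case 1
    then show ?thesis using len by (simp add: part_beyond NU1_eq)
  next
    case 2
    then show ?thesis by (simp add: nth_append NU1_eq part_Cons)
  next
    case 3
    have "part \<gamma> (length \<gamma> + 1 - i) > 0" using 3 by (intro part_pos[OF assms]) auto
    moreover have "part (NU1 \<gamma>) (length \<gamma> + 2 - i) = part \<gamma> (length \<gamma> + 1 - i) - 1"
      using 3 by (simp add: NU1_eq part_Cons part_drop_column[OF assms])
    moreover have "i - Suc 0 < length \<gamma>" using 3 by linarith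
    ultimately show ?thesis using 3
      by (simp add: nth_Cons' nth_append nth_tl)
  qed
qed simp

lemma qdv_Cons_0: "qdv_of_partition (length \<gamma> + 1) \<gamma> = 0 # tl (qdv_of_partition (length \<gamma> + 1) \<gamma>)"
  by (rule nth_equalityI) (auto simp: nth_Cons' nth_tl part_beyond)

lemma defc_NU1:
  assumes "is_partition \<gamma>"
  shows "defc (NU1 \<gamma>) = defc \<gamma>"
proof -
  have "length (NU1 \<gamma>) < length \<gamma> + 2"
    using length_drop_column[OF assms] by (simp add: NU1_eq)
  then have "defc (NU1 \<gamma>) = defc_qdv (qdv_of_partition (length \<gamma> + 2) (NU1 \<gamma>))"
    by (simp add: defc_qdv_of_partition)
  also have "\<dots> = defc_qdv (qdv_of_partition (length \<gamma> + 1) \<gamma>)"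
    by (simp only: qdv_NU1[OF assms] defc_qdv_rotate flip: qdv_Cons_0)
  finally show ?thesis by (simp add: defc_qdv_of_partition)
qed

section \<open>Chains\<close>

text \<open>The zero partition is included, since values of \<open>NU1\<close> are never
  empty.\<close>

definition chain_start :: "nat list \<Rightarrow> bool" where
  "chain_start \<gamma> \<longleftrightarrow> is_partition \<gamma> \<and> (\<gamma> \<noteq> [] \<longrightarrow> hd \<gamma> < length \<gamma>)"

text \<open>Allowing an arbitrary first term separates existence and uniqueness of the chain through
  a partition from the question which chains are tails.\<close>

inductive_set chain :: "nat list \<Rightarrow> nat list set" for \<sigma> where
  base: "\<sigma> \<in> chain \<sigma>"
| step: "\<gamma> \<in> chain \<sigma> \<Longrightarrow> NU1_dom \<gamma> \<Longrightarrow> NU1 \<gamma> \<in> chain \<sigma>"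

lemma TAIL_eq_chain: "TAIL \<mu> = chain (TI \<mu>)"
proof (intro set_eqI iffI)
  show "\<gamma> \<in> chain (TI \<mu>)" if "\<gamma> \<in> TAIL \<mu>" for \<gamma>
    using that by induction (auto intro: chain.intros)
  show "\<gamma> \<in> TAIL \<mu>" if "\<gamma> \<in> chain (TI \<mu>)" for \<gamma>
    using that by induction (auto intro: TAIL.intros)
qed

lemma not_chain_start_NU1:
  assumes "NU1_dom \<gamma>"
  shows "\<not> chain_start (NU1 \<gamma>)"
  using length_drop_column[of \<gamma>] assms by (auto simp: chain_start_def NU1_eq NU1_dom_def)

text \<open>By injectivity two chains through the same partition have the same predecessors; walking
  back, both must stop at the same place, because a starting point has no predecessor.\<close>

lemma chain_start_unique:
  assumes "\<gamma> \<in> chain \<sigma>" "\<gamma> \<in> chain \<tau>" "chain_start \<sigma>" "chain_start \<tau>"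
  shows "\<sigma> = \<tau>"
  using assms
proof (induction)
  case base
  then show ?case using not_chain_start_NU1 by (auto elim: chain.cases)
next
  case (step \<gamma>)
  note step_IH = step.IH
  from step.prems(1) show ?case
  proof cases
    case base
    then show ?thesis using step not_chain_start_NU1 by metis
  next
    case (step \<delta>)
    with \<open>NU1_dom \<gamma>\<close> have "\<gamma> = \<delta>" by (auto simp: NU1_dom_def intro: NU1_inj)
    with step step_IH \<open>chain_start \<sigma>\<close> \<open>chain_start \<tau>\<close> show ?thesis by blast
  qed
qed

lemma NU1_surj:
  assumes "is_partition \<gamma>" "\<not> chain_start \<gamma>"
  obtains \<delta> where "NU1_dom \<delta>" "NU1 \<delta> = \<gamma>" "sum_list \<delta> < sum_list \<gamma>"
proof -
  obtain a \<beta> where \<gamma>: "\<gamma> = a # \<beta>"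
    using assms by (cases \<gamma>) (auto simp: chain_start_def)
  have len: "length \<beta> < a" using assms \<gamma> by (auto simp: chain_start_def)
  \<comment> \<open>The first row of length \<open>a\<close> is removed and a column of height
    \<open>a - 1\<close> is added, so the size drops by one. This decrease makes the walk back to a
    starting point terminate.\<close>
  define \<delta> where "\<delta> = map Suc \<beta> @ replicate (a - 1 - length \<beta>) 1"
  have \<beta>: "is_partition \<beta>" "\<forall>b\<in>set \<beta>. b \<le> a" using assms(1) \<gamma> by (auto simp: is_partition_Cons)
  have "is_partition \<delta>"
    using \<beta>(1) unfolding \<delta>_def is_partition_def
    by  (auto simp: sorted_wrt_append sorted_wrt_map sorted_wrt_iff_nth_less[of _ "replicate _ _"])
  moreover have "part \<delta> 1 \<le> length \<delta> + 2"
    using \<beta>(2) len unfolding part_1 \<delta>_def by (cases \<beta>) (auto simp: hd_append)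
  moreover have "NU1 \<delta> = \<gamma>"
  proof -
    have "drop_column (map Suc \<beta> @ replicate n 1) = \<beta>" for n
      using \<beta>(1)
    proof (induction \<beta>)
      case Nil
      show ?case by (simp add: drop_column_ones)
    qed (auto simp: is_partition_Cons)
    then show ?thesis using len unfolding NU1_eq \<delta>_def \<gamma> by simp
  qed
  moreover have "sum_list (map Suc \<beta>) = sum_list \<beta> + length \<beta>" by (induction \<beta>) auto
  then have "sum_list \<delta> < sum_list \<gamma>" using len by (simp add: \<delta>_def \<gamma> sum_list_replicate)
  ultimately show ?thesis by (intro that) (auto simp: NU1_dom_def)
qed

lemma in_some_chain:
  "is_partition \<gamma> \<Longrightarrow> \<exists>\<sigma>. chain_start \<sigma> \<and> \<gamma> \<in> chain \<sigma>"
proof (induction "sum_list \<gamma>" arbitrary: \<gamma> rule: less_induct)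
  case less
  show ?case
  proof (cases "chain_start \<gamma>")
    case True
    then show ?thesis using chain.base by blast
  next
    case False
    then obtain \<delta> where "NU1_dom \<delta>" "NU1 \<delta> = \<gamma>" "sum_list \<delta> < sum_list \<gamma>"
      using NU1_surj less.prems by blast
    with less.hyps[of \<delta>] show ?thesis using chain.step by (metis NU1_dom_def)
  qed
qed

lemma defc_chain: "\<gamma> \<in> chain \<sigma> \<Longrightarrow> defc \<gamma> = defc \<sigma>"
  by (induction rule: chain.induct) (auto simp: NU1_dom_def defc_NU1)

lemma finite_chain:
  assumes "\<not> NU1_dom ((NU1 ^^ t) \<sigma>)"
  shows "finite (chain \<sigma>)"
proof -
  have "\<gamma> \<in> (\<lambda>s. (NU1 ^^ s) \<sigma>) ` {..t}" if "\<gamma> \<in> chain \<sigma>" for \<gamma>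
    using that
  proof induction
    case base
    show ?case by (rule image_eqI[of _ _ 0]) auto
  next
    case (step \<gamma>)
    then obtain s where s: "s \<le> t" "\<gamma> = (NU1 ^^ s) \<sigma>" by auto
    then have "Suc s \<le> t" using assms step by (cases "s = t") auto
    then show ?case using s by (intro image_eqI[of _ _ "Suc s"]) auto
  qed
  then show ?thesis by (meson finite_atMost finite_imageI finite_subset subsetI)
qed

section \<open>Finiteness of the starting points\<close>

definition positives :: "int list \<Rightarrow> nat" where
  "positives w = length (filter (\<lambda>y. 1 \<le> y) w)"

lemma count_pair_le_positives:
  "1 \<le> x \<Longrightarrow> count_list w x + count_list w (x + 1) \<le> positives w"
  by (induction w) (auto simp: positives_def)

lemma count_pair_le_length: "count_list w x + count_list w (x + 1) \<le> length w" for x :: int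
  by (metis length_filter_le length_filter_pair)

text \<open>A value of at least \<open>x\<close> can occur only from index \<open>x\<close>
  on.\<close>

lemma length_filter_ge:
  assumes "\<forall>i<length w. w ! i \<le> int i"
  shows "length (filter (\<lambda>y. int x \<le> y) w) \<le> length w - x"
proof -
  have "{i. i < length w \<and> int x \<le> w ! i} \<subseteq> {x..<length w}" using assms by force
  then have "card {i. i < length w \<and> int x \<le> w ! i} \<le> card {x..<length w}"
    by (intro card_mono) auto
  then show ?thesis by (simp add: length_filter_conv_card)
qed

lemma count_pair_le_length_minus:
  assumes "\<forall>i<length w. w ! i \<le> int i"
  shows "count_list w (int x) + count_list w (int x + 1) \<le> length w - x"
proof -
  have "count_list w (int x) + count_list w (int x + 1) \<le> length (filter (\<lambda>y. int x \<le> y) w)"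
    unfolding length_filter_pair[symmetric]
    by (induction w) auto
  then show ?thesis using length_filter_ge[OF assms, of x] by linarith
qed

text \<open>Appending \<open>x\<close> never lowers the deficit. For a positive \<open>x\<close> at
  most \<open>length w - x\<close> entries of \<open>w\<close> equal \<open>x\<close> or
  \<open>x + 1\<close>, so the deficit rises by at least 1.\<close>

lemma positives_le_defc:
  "\<forall>i<length w. w ! i \<le> int i \<Longrightarrow> int (positives w) \<le> defc_qdv (0 # w)"
proof (induction w rule: rev_induct)
  case Nil
  show ?case by (simp add: positives_def defc_qdv_0)
next
  case (snoc x w)
  have w: "\<forall>i<length w. w ! i \<le> int i"
    using snoc.prems by (auto simp: nth_append dest: spec[of _ _] split: if_splits)
  have x: "x \<le> int (length w)" using snoc.prems by (auto dest: spec[of _ "length w"])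
  have rec: "defc_qdv (0 # w @ [x]) = defc_qdv (0 # w) + int (length w) + 1 - x
     - int (count_list (0 # w) x) - int (count_list (0 # w) (x + 1)) - ramp_pairs x"
    using defc_qdv_snoc[of "0 # w" x] by simp
  have "x \<ge> 1 \<Longrightarrow> count_list w x + count_list w (x + 1) \<le> length w - nat x"
    using count_pair_le_length_minus[OF w, of "nat x"] by simp
  moreover note count_pair_le_length[of w x] snoc.IH[OF w] x
  ultimately show ?case unfolding append_Cons rec
    by (auto simp: positives_def ramp_pairs_def)
qed

text \<open>A QDV climbs by at most one per step, and each step that reaches a positive value
  contributes a positive entry.\<close>

lemma last_le_positives:
  "\<forall>i<length w. (0 # w) ! Suc i \<le> (0 # w) ! i + 1 \<Longrightarrow> last (0 # w) \<le> int (positives w)"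
proof (induction w rule: rev_induct)
  case (snoc x w)
  have "\<forall>i<length w. (0 # w) ! Suc i \<le> (0 # w) ! i + 1"
  proof (intro allI impI)
    fix i assume "i < length w"
    then show "(0 # w) ! Suc i \<le> (0 # w) ! i + 1"
      using snoc.prems[rule_format, of i]
      by (cases i) (auto simp: nth_append nth_Cons' split: if_splits)
  qed
  with snoc.IH have "last (0 # w) \<le> int (positives w)" by blast
  moreover have "x \<le> last (0 # w) + 1"
    using snoc.prems[rule_format, of "length w"]
    by (auto simp: nth_append nth_Cons' last_conv_nth split: if_splits)
  ultimately show ?case by (auto simp: positives_def)
qed (simp add: positives_def)

lemma tl_qdv:
  assumes "is_partition \<gamma>"
  shows "\<forall>i<length \<gamma>. tl (qdv_of_partition (length \<gamma> + 1) \<gamma>) ! i =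
    int i + 1 - int (part \<gamma> (length \<gamma> - i))"
    and "\<forall>i<length \<gamma>. tl (qdv_of_partition (length \<gamma> + 1) \<gamma>) ! i \<le> int i"
proof -
  show 1: "\<forall>i<length \<gamma>. tl (qdv_of_partition (length \<gamma> + 1) \<gamma>) ! i =
    int i + 1 - int (part \<gamma> (length \<gamma> - i))"
    by (simp add: nth_tl)
  have "part \<gamma> (length \<gamma> - i) > 0" if "i < length \<gamma>" for i
    using that by (intro part_pos[OF assms]) auto
  then show "\<forall>i<length \<gamma>. tl (qdv_of_partition (length \<gamma> + 1) \<gamma>) ! i \<le> int i"
    using 1 by force
qed

lemma last_tl_qdv:
  assumes "\<gamma> \<noteq> []"
  shows "last (tl (qdv_of_partition (length \<gamma> + 1) \<gamma>)) = int (length \<gamma>) - int (hd \<gamma>)"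
proof -
  have "tl (qdv_of_partition (length \<gamma> + 1) \<gamma>) \<noteq> []" using assms
    by (metis length_qdv length_tl add_diff_cancel_right' length_0_conv)
  then show ?thesis using assms
    by (cases \<gamma>) (auto simp: last_conv_nth nth_tl part_def)
qed

text \<open>Write the QDV as \<open>0w'y\<close>. Here \<open>y\<close> is positive, hence at most
  \<open>k\<close>, and the pairs it forms are at most as many as the positive entries of
  \<open>w'\<close>, which the deficit of \<open>0w'\<close> pays for. So
  \<open>length w - y \<le> k\<close>.\<close>

lemma chain_start_bound:
  assumes "chain_start \<sigma>" "defc \<sigma> = int k"
  shows "length \<sigma> \<le> 2 * k"
proof (cases "\<sigma> = []")
  case False
  define w where "w = tl (qdv_of_partition (length \<sigma> + 1) \<sigma>)"
  have part: "is_partition \<sigma>" and lt: "hd \<sigma> < length \<sigma>" using assms False by (auto simp: chain_start_def)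
  have v: "qdv_of_partition (length \<sigma> + 1) \<sigma> = 0 # w" unfolding w_def by (rule qdv_Cons_0)
  have len: "length w = length \<sigma>" by (simp add: w_def)
  have le: "\<forall>i<length w. w ! i \<le> int i" using tl_qdv(2)[OF part] by (simp add: w_def)
  have defc: "defc_qdv (0 # w) = int k"
    using defc_qdv_of_partition[of \<sigma> "length \<sigma> + 1"] v assms(2) by simp
  have "QDV (0 # w)" using QDV_qdv[OF part, of "length \<sigma> + 1"] v by simp
  then have "last (0 # w) \<le> int (positives w)"
    by (intro last_le_positives) (auto simp: QDV_def)
  then have y_le: "last w \<le> int k"
    using positives_le_defc[OF le] defc len False by (cases w) auto
  have y_ge: "1 \<le> last w" using last_tl_qdv[OF False] lt by (simp add: w_def)
  obtain w' y where w': "w = w' @ [y]" using len False by (metis length_0_conv rev_exhaust)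
  have le': "\<forall>i<length w'. w' ! i \<le> int i"
  proof (intro allI impI)
    fix i assume "i < length w'"
    then show "w' ! i \<le> int i" using le[rule_format, of i] w' by (simp add: nth_append)
  qed
  have y: "1 \<le> y" "y \<le> int k" using y_ge y_le w' by auto
  have "defc_qdv (0 # w' @ [y]) = defc_qdv (0 # w') + int (length w') + 1 - y
     - int (count_list w' y) - int (count_list w' (y + 1))"
    using defc_qdv_snoc[of "0 # w'" y] y by (simp add: ramp_pairs_def)
  then show ?thesis
    using positives_le_defc[OF le'] count_pair_le_positives[OF y(1), of w'] y defc w' len by simp
qed simp

lemma finite_chain_starts: "finite {\<sigma>. chain_start \<sigma> \<and> defc \<sigma> = int k}"
proof (rule finite_subset)
  show "{\<sigma>. chain_start \<sigma> \<and> defc \<sigma> = int k} \<subseteq> {xs. set xs \<subseteq> {..2 * k} \<and> length xs \<le> 2 * k}"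
  proof clarify
    fix \<sigma> assume a: "chain_start \<sigma>" "defc \<sigma> = int k"
    have "x \<le> 2 * k" if "x \<in> set \<sigma>" for x
      using that a chain_start_bound[OF a] le_part_1[of \<sigma> x]
      unfolding chain_start_def part_1 by (auto split: if_splits)
    then show "set \<sigma> \<subseteq> {..2 * k} \<and> length \<sigma> \<le> 2 * k" using chain_start_bound[OF a] by auto
  qed
qed (simp add: finite_lists_length_le)

section \<open>Token words\<close>

text \<open>A leading token above 2 is treated like 2; \<open>live\<close> says that this case never
  arises.\<close>

definition token_step :: "nat list \<Rightarrow> nat list" where
  "token_step L = (let L' = tl L in
     if hd L = 0 then L' @ [0, 1]
     else if hd L = 1 then L' @ [1]
     else butlast L' @ [Suc (last L')])"

definition live :: "nat list \<Rightarrow> bool" where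
  "live L \<longleftrightarrow> (\<forall>t. hd ((token_step ^^ t) L) \<le> 2)"

lemma live_hd: "live L \<Longrightarrow> hd L \<le> 2"
  unfolding live_def by (metis funpow_0)

lemma live_token_step: "live L \<Longrightarrow> live (token_step L)"
  unfolding live_def by (metis funpow_Suc_right comp_apply)

lemma live_Cons_0: "live (0 # L) \<Longrightarrow> live (L @ [0, 1])"
  using live_token_step[of "0 # L"] by (simp add: token_step_def)

lemma live_Cons_1: "live (1 # L) \<Longrightarrow> live (L @ [1])"
  using live_token_step[of "1 # L"] by (simp add: token_step_def)

lemma live_Cons_2: "live (2 # L @ [c]) \<Longrightarrow> live (L @ [Suc c])"
  using live_token_step[of "2 # L @ [c]"] by (simp add: token_step_def butlast_append)

text \<open>The tokens in front of \<open>x\<close> are consumed one by one. Meanwhile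
  \<open>x\<close> can only grow, namely when it is last, and finally it stands at the
  front.\<close>

lemma live_le_2: "live (P @ x # Q) \<Longrightarrow> x \<le> 2"
proof (induction P arbitrary: x Q)
  case Nil
  then show ?case using live_hd by fastforce
next
  case (Cons p P)
  then have "p \<le> 2" using live_hd by fastforce
  then consider "p = 0" | "p = 1" | "p = 2" by linarith
  then show ?case
  proof cases
    case 1
    then show ?thesis using live_Cons_0[of "P @ x # Q"] Cons by simp
  next
    case 2
    then show ?thesis using live_Cons_1[of "P @ x # Q"] Cons by simp
  next
    case 3
    show ?thesis
    proof (cases Q rule: rev_cases)
      case Nil
      then show ?thesis using live_Cons_2[of P x] Cons.IH[of "Suc x" "[]"] Cons.prems 3 by simp
    next
      case (snoc Q' c)
      then show ?thesis using live_Cons_2[of "P @ x # Q'" c] Cons 3 by simp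
    qed
  qed
qed

lemma live_rotate_ones: "live (replicate a 1 @ L) \<Longrightarrow> live (L @ replicate a 1)"
proof (induction a arbitrary: L)
  case (Suc a)
  then have "live (replicate a 1 @ L @ [1])"
    using live_Cons_1[of "replicate a 1 @ L"] by simp
  from Suc.IH[OF this] show ?case by simp
qed simp

text \<open>One round of the descent on \<open>a\<close>; the assumption \<open>IH\<close> covers
  the next smaller distance. The condition on \<open>Q\<close> ensures that a 2 is never absorbed by
  a final 0, and every step preserves it.\<close>

lemma not_live_two_twos_aux:
  assumes Q: "Q = [] \<or> 1 \<le> last Q"
    and IH: "\<And>P a'. a = Suc a' \<Longrightarrow> \<not> live (P @ 2 # replicate a' 1 @ [2])"
  shows "\<not> live (P @ 2 # replicate a 1 @ 2 # Q)"
proof -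
  have base: "\<not> live (2 # replicate a 1 @ 2 # Q)"
    if Q: "Q = [] \<or> 1 \<le> last Q" for Q
  proof
    assume live: "live (2 # replicate a 1 @ 2 # Q)"
    show False
    proof (cases Q rule: rev_cases)
      case Nil
      then have "live (replicate a 1 @ [3])"
        using live_Cons_2[of "replicate a 1" 2] live by (simp add: eval_nat_numeral)
      then show False using live_le_2 by fastforce
    next
      case (snoc Q' c)
      then have *: "live ((replicate a 1 @ 2 # Q') @ [Suc c])"
        using live_Cons_2[of "replicate a 1 @ 2 # Q'" c] live by simp
      then have "Suc c \<le> 2" by (rule live_le_2)
      \<comment> \<open>The front 2 is absorbed into the final token, which must become exactly 2:
        above 2 it would be fatal, and it was at least 1.\<close>
      then have "c = 1" using Q snoc by simp
      then have "live (replicate a 1 @ 2 # Q' @ [2])" using * by (simp add: eval_nat_numeral)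
      then have **: "live (2 # Q' @ [2] @ replicate a 1)"
        using live_rotate_ones[of a "2 # Q' @ [2]"] by simp
      show False
      proof (cases a)
        case 0
        then have "live (Q' @ [3])" using ** live_Cons_2[of Q' 2] by (simp add: eval_nat_numeral)
        then show False using live_le_2 by fastforce
      next
        \<comment> \<open>After the \<open>a\<close> ones have moved to the end, the other 2 is
          absorbed into the last of them. The two tokens 2 are now separated by one token
          fewer.\<close>
        case (Suc a')
        then have "2 # Q' @ [2] @ replicate a 1 = 2 # (Q' @ 2 # replicate a' 1) @ [1]"
          by (simp add: replicate_append_same)
        then have "live (Q' @ 2 # replicate a' 1 @ [2])"
          using ** live_Cons_2[of "Q' @ 2 # replicate a' 1" 1] by (simp add: eval_nat_numeral)
        then show False using IH[OF Suc] by blast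
      qed
    qed
  qed
  show ?thesis
    using Q
  \<comment> \<open>Consuming \<open>P\<close> from the left brings the pair to the front, while
    only the end of the word changes.\<close>
  proof (induction P arbitrary: Q)
    case Nil
    then show ?case using base by simp
  next
    case (Cons p P)
    show ?case
    proof
      assume live: "live ((p # P) @ 2 # replicate a 1 @ 2 # Q)"
      then have "p \<le> 2" using live_hd by fastforce
      then consider "p = 0" | "p = 1" | "p = 2" by linarith
      then show False
      proof cases
        case 1
        then show ?thesis
          using live live_Cons_0[of "P @ 2 # replicate a 1 @ 2 # Q"] Cons.IH[of "Q @ [0, 1]"] by simp
      next
        case 2
        then show ?thesis
          using live live_Cons_1[of "P @ 2 # replicate a 1 @ 2 # Q"] Cons.IH[of "Q @ [1]"] by simp
      next
        case 3
        show ?thesis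
        proof (cases Q rule: rev_cases)
          case Nil
          then have "live ((P @ 2 # replicate a 1) @ [3])"
            using live 3 live_Cons_2[of "P @ 2 # replicate a 1" 2] by (simp add: eval_nat_numeral)
          then show False using live_le_2 by fastforce
        next
          case (snoc Q' c)
          then show ?thesis
            using live 3 live_Cons_2[of "P @ 2 # replicate a 1 @ 2 # Q'" c]
              Cons.IH[of "Q' @ [Suc c]"] by simp
        qed
      qed
    qed
  qed
qed

text \<open>Each time the word is traversed, the distance between two tokens \<open>2\<close> that are separated
  only by tokens \<open>1\<close> shrinks by one, until they merge into a token \<open>3\<close>.\<close>

lemma not_live_two_twos:
  "Q = [] \<or> 1 \<le> last Q \<Longrightarrow> \<not> live (P @ 2 # replicate a 1 @ 2 # Q)"
proof (induction a arbitrary: P Q)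
  case 0
  then show ?case using not_live_two_twos_aux[of Q 0 P] by blast
next
  case (Suc a)
  from Suc.prems show ?case
    by (rule not_live_two_twos_aux) (use Suc.IH[of "[]"] in simp)
qed

definition excess :: "nat list \<Rightarrow> int" where
  "excess L = int (sum_list L) - int (length L)"

lemma excess_append: "excess (L @ M) = excess L + excess M"
  by (simp add: excess_def)

text \<open>Between two tokens 2 there must be a 0, so the twos outnumber the zeros by at most one.
  The second bound, for words whose first token other than 1 is not a 2, is what the induction uses
  when a 2 is prepended.\<close>

lemma excess_bounds:
  assumes "\<forall>x\<in>set L. x \<le> 2" "\<nexists>P a Q. L = P @ 2 # replicate a 1 @ 2 # Q"
  shows "excess L \<le> 1 \<and> ((\<nexists>a Q. L = replicate a 1 @ 2 # Q) \<longrightarrow> excess L \<le> 0)"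
  using assms
proof (induction L)
  case Nil
  show ?case by (simp add: excess_def)
next
  case (Cons x L)
  have "\<nexists>P a Q. L = P @ 2 # replicate a 1 @ 2 # Q"
    using Cons.prems(2) by (metis append_Cons)
  then have IH: "excess L \<le> 1" "(\<nexists>a Q. L = replicate a 1 @ 2 # Q) \<Longrightarrow> excess L \<le> 0"
    using Cons by auto
  have ex: "excess (x # L) = int x - 1 + excess L" by (simp add: excess_def)
  have "x \<le> 2" using Cons.prems(1) by simp
  then consider "x = 0" | "x = 1" | "x = 2" by linarith
  then show ?case
  proof cases
    case 1
    then show ?thesis using IH ex by simp
  next
    case 2
    then have "\<nexists>a Q. L = replicate a 1 @ 2 # Q" if "\<nexists>a Q. x # L = replicate a 1 @ 2 # Q"
      using that by (metis append_Cons replicate_Suc)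
    then show ?thesis using IH ex 2 by auto
  next
    case 3
    then have "\<nexists>a Q. L = replicate a 1 @ 2 # Q" using Cons.prems(2) by (metis append_Nil)
    moreover have "\<exists>a Q. x # L = replicate a 1 @ 2 # Q"
      using 3 by (metis append_Nil replicate_0)
    ultimately show ?thesis using IH(2) ex 3 by simp
  qed
qed

section \<open>Multiplicity words of partitions\<close>

text \<open>The extra part anticipates the next row: losing one column turns it into the first part
  of \<open>NU1 \<gamma>\<close>.\<close>

definition tokens :: "nat list \<Rightarrow> nat list" where
  "tokens \<gamma> = map (count_list ((length \<gamma> + 2) # \<gamma>)) [1..<length \<gamma> + 3]"

lemma hd_tokens: "hd (tokens \<gamma>) = count_list \<gamma> 1"
  by (simp add: tokens_def upt_rec)

text \<open>If \<open>b\<close> parts equal 1, then \<open>NU1 \<gamma>\<close> has first part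
  \<open>length \<gamma> + 1\<close> and length \<open>length \<gamma> + 1 - b\<close>.\<close>

lemma NU1_dom_NU1:
  assumes "NU1_dom \<gamma>"
  shows "NU1_dom (NU1 \<gamma>) \<longleftrightarrow> hd (tokens \<gamma>) \<le> 2"
  using is_partition_NU1[OF assms] length_drop_column[of \<gamma>] assms
  unfolding hd_tokens by (auto simp: NU1_dom_def NU1_eq part_Cons)

lemma tokens_NU1:
  assumes "NU1_dom \<gamma>" "hd (tokens \<gamma>) \<le> 2"
  shows "tokens (NU1 \<gamma>) = token_step (tokens \<gamma>)"
proof -
  define l where "l = length \<gamma>"
  define b where "b = count_list \<gamma> 1"
  define \<rho> where "\<rho> = drop_column \<gamma>"
  have part: "is_partition \<gamma>" using assms(1) by (simp add: NU1_dom_def)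
  have b: "b \<le> 2" "b = hd (tokens \<gamma>)" using assms(2) by (simp_all add: hd_tokens b_def)
  have len: "length \<rho> + b = l"
    using length_drop_column[OF part] by (simp add: \<rho>_def b_def l_def)
  have le: "p \<le> l + 1" if "p \<in> set \<rho>" for p
    using that assms(1) le_part_1[OF part] by (force simp: \<rho>_def set_drop_column NU1_dom_def l_def)
  define g where "g = count_list ((l + 1) # \<rho>)"
  have g_big: "g x = 0" if "l + 1 < x" for x
    using that le by (force simp: g_def count_list_0_iff)
  have NU1: "tokens (NU1 \<gamma>) = map (count_list ((l + 3 - b) # (l + 1) # \<rho>)) [1..<l + 4 - b]"
  proof -
    have "length (NU1 \<gamma>) + 2 = l + 3 - b" "length (NU1 \<gamma>) + 3 = l + 4 - b"
      using len by (auto simp: NU1_eq \<rho>_def[symmetric])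
    then show ?thesis unfolding tokens_def by (simp add: NU1_eq \<rho>_def l_def)
  qed
  \<comment> \<open>Without its first token, the word lists the multiplicities in
    \<open>NU1 \<gamma>\<close> of \<open>1, ..., l + 1\<close>. What remains is to add the new
    extra part \<open>l + 3 - b\<close>: it lies two places beyond the end, one place beyond it, or
    at the last place.\<close>
  have tl: "tl (tokens \<gamma>) = map g [1..<l + 2]"
  proof -
    have "tl (tokens \<gamma>) = map (count_list ((l + 2) # \<gamma>)) [Suc 1..<Suc (l + 2)]"
      by (simp only: tokens_def l_def map_tl[symmetric] tl_upt) (simp add: eval_nat_numeral)
    also have "\<dots> = map (\<lambda>x. count_list ((l + 2) # \<gamma>) (Suc x)) [1..<l + 2]"
      unfolding map_Suc_upt[symmetric] map_map comp_def ..
    also have "\<dots> = map g [1..<l + 2]"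
      by (rule map_cong) (auto simp: g_def \<rho>_def count_drop_column)
    finally show ?thesis .
  qed
  consider "b = 0" | "b = 1" | "b = 2" using b by linarith
  then show ?thesis
  proof cases
    case 1
    have "[1..<l + 4] = [1..<l + 2] @ [l + 2, l + 3]" by (simp add: eval_nat_numeral)
    then have "tokens (NU1 \<gamma>) = map g [1..<l + 2] @ [0, 1]"
      using 1 g_big[of "l + 2"] g_big[of "l + 3"] unfolding NU1 g_def by simp
    then show ?thesis using 1 b(2) by (simp add: token_step_def tl)
  next
    case 2
    have upt: "l + 3 - b = l + 2" "[1..<l + 4 - b] = [1..<l + 2] @ [l + 2]"
      using 2 by (simp_all add: eval_nat_numeral)
    have "tokens (NU1 \<gamma>) = map g [1..<l + 2] @ [1]"
      using g_big[of "l + 2"] unfolding NU1 upt g_def by (simp del: upt_Suc)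
    then show ?thesis using 2 b(2) by (simp add: token_step_def tl)
  next
    case 3
    have "[1..<l + 2] = [1..<l + 1] @ [l + 1]" by simp
    then have "tokens (NU1 \<gamma>) = map g [1..<l + 1] @ [Suc (g (l + 1))]"
      "map g [1..<l + 2] = map g [1..<l + 1] @ [g (l + 1)]"
      using 3 unfolding NU1 g_def by simp_all
    then show ?thesis using 3 b(2) by (simp add: token_step_def tl)
  qed
qed

section \<open>Starting points of infinite chains\<close>

definition immortal :: "nat list \<Rightarrow> bool" where
  "immortal \<sigma> \<longleftrightarrow> (\<forall>t. NU1_dom ((NU1 ^^ t) \<sigma>))"

lemma live_tokens:
  assumes "immortal \<sigma>"
  shows "live (tokens \<sigma>)"
proof -
  have dom: "NU1_dom ((NU1 ^^ t) \<sigma>)" for t using assms by (simp add: immortal_def)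
  have hd: "hd (tokens ((NU1 ^^ t) \<sigma>)) \<le> 2" for t
    using NU1_dom_NU1[OF dom[of t]] dom[of "Suc t"] by simp
  have "tokens ((NU1 ^^ t) \<sigma>) = (token_step ^^ t) (tokens \<sigma>)" for t
    by (induction t) (use tokens_NU1[OF dom hd] in simp_all)
  then show ?thesis using hd by (simp add: live_def)
qed

lemma length_filter_Suc:
  "length (filter (\<lambda>p. p \<le> Suc x) \<gamma>) = length (filter (\<lambda>p. p \<le> x) \<gamma>) + count_list \<gamma> (Suc x)"
  by (induction \<gamma>) auto

lemma sum_list_multiplicities:
  assumes "0 \<notin> set \<gamma>"
  shows "sum_list (map (count_list \<gamma>) [1..<Suc x]) = length (filter (\<lambda>p. p \<le> x) \<gamma>)"
proof (induction x)
  case 0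
  show ?case using assms by (simp add: filter_empty_conv) (metis gr0I)
qed (simp add: length_filter_Suc)

text \<open>Counted from the smallest, \<open>p\<close> is the part of rank
  \<open>i + 1\<close>.\<close>

lemma length_filter_le_part:
  assumes "is_partition \<gamma>" "i < length \<gamma>"
  defines "p \<equiv> part \<gamma> (length \<gamma> - i)"
  shows "i < length (filter (\<lambda>q. q \<le> p) \<gamma>)" "length (filter (\<lambda>q. q \<le> p - 1) \<gamma>) \<le> i"
proof -
  define l where "l = length \<gamma>"
  define m where "m = l - i - 1"
  have m: "m < l" "l - i = Suc m" using assms(2) by (auto simp: m_def l_def)
  have p: "p = \<gamma> ! m" "0 < p"
    using m part_pos[OF assms(1), of "l - i"] by (auto simp: p_def l_def part_def)
  have le: "\<gamma> ! k \<le> \<gamma> ! j" if "j \<le> k" "k < l" for j k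
    using that assms(1) unfolding is_partition_def l_def
    by (cases "j = k") (auto simp: sorted_wrt_iff_nth_less)
  have "card {m..<l} \<le> card {j. j < l \<and> \<gamma> ! j \<le> p}"
    using le m p by (intro card_mono) auto
  then show "i < length (filter (\<lambda>q. q \<le> p) \<gamma>)"
    using m by (simp add: length_filter_conv_card l_def)
  have "{j. j < l \<and> \<gamma> ! j \<le> p - 1} \<subseteq> {Suc m..<l}"
  proof
    fix j assume "j \<in> {j. j < l \<and> \<gamma> ! j \<le> p - 1}"
    then show "j \<in> {Suc m..<l}" using le[of j m] p m by (cases "j \<le> m") auto
  qed
  then have "card {j. j < l \<and> \<gamma> ! j \<le> p - 1} \<le> card {Suc m..<l}"
    by (intro card_mono) auto
  then show "length (filter (\<lambda>q. q \<le> p - 1) \<gamma>) \<le> i"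
    using m by (simp add: length_filter_conv_card l_def)
qed

text \<open>These words turn out to be exactly the words \<open>B \<mu>\<close> of partitions
  \<mu>.\<close>

definition binary_word :: "int list \<Rightarrow> bool" where
  "binary_word w \<longleftrightarrow> set w \<subseteq> {0, 1} \<and> (w \<noteq> [] \<longrightarrow> hd w = 0 \<and> last w = 1)"

lemma immortal_start_binary:
  assumes "chain_start \<sigma>" "immortal \<sigma>"
  shows "binary_word (tl (qdv_of_partition (length \<sigma> + 1) \<sigma>))"
proof (cases "\<sigma> = []")
  case True
  then show ?thesis by (simp add: binary_word_def qdv_of_partition_def)
next
  case False
  define l where "l = length \<sigma>"
  have part: "is_partition \<sigma>" and lt: "hd \<sigma> < l" using assms False by (auto simp: chain_start_def l_def)
  have nz: "0 \<notin> set \<sigma>" using part by (simp add: is_partition_def)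
  have lt': "p < l" if "p \<in> set \<sigma>" for p
    using le_part_1[OF part that] lt False unfolding part_1 by simp
  have l: "0 < l" using False by (simp add: l_def)
  define V where "V = map (count_list \<sigma>) [1..<l]"
  have tokens: "tokens \<sigma> = V @ [0, 0, 1]"
  proof -
    have upt: "[1..<l + 3] = [1..<l] @ [l, l + 1, l + 2]" using l by (simp add: eval_nat_numeral)
    have "count_list \<sigma> x = 0" if "l \<le> x" for x
      using that lt' by (force simp: count_list_0_iff)
    then show ?thesis
      unfolding tokens_def l_def[symmetric] upt by (simp add: V_def)
  qed
  have live: "live (V @ [0, 0, 1])" using live_tokens[OF assms(2)] tokens by simp
  have le2: "\<forall>x\<in>set V. x \<le> 2"
  proof
    fix x assume "x \<in> set V"
    then obtain P Q where "V = P @ x # Q" by (meson split_list)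
    then show "x \<le> 2" using live live_le_2[of P x "Q @ [0, 0, 1]"] by simp
  qed
  \<comment> \<open>Two forbidden tokens 2 in \<open>L\<close> are also in the whole word, whose
    last token is 1, so the condition on the right-hand end holds.\<close>
  have factor: "excess L \<le> 1" if "V = X @ L @ Y" for X L Y
  proof (rule excess_bounds[THEN conjunct1])
    show "\<forall>x\<in>set L. x \<le> 2" using le2 that by auto
    show "\<nexists>P a Q. L = P @ 2 # replicate a 1 @ 2 # Q"
    proof clarify
      fix P a Q assume "L = P @ 2 # replicate a 1 @ 2 # Q"
      then show False
        using live that not_live_two_twos[of "Q @ Y @ [0, 0, 1]" "X @ P" a] by simp
    qed
  qed
  define C where "C x = length (filter (\<lambda>p. p \<le> x) \<sigma>)" for x
  have take: "take x V = map (count_list \<sigma>) [1..<Suc x]" if "x < l" for x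
    using that by (simp add: V_def take_map)
  have ex_take: "excess (take x V) = int (C x) - int x" if "x < l" for x
    using that sum_list_multiplicities[OF nz, of x] by (simp add: take excess_def C_def)
  \<comment> \<open>All \<open>l\<close> parts are below \<open>l\<close>, so \<open>V\<close> has
    total excess 1. A prefix and its complementary suffix each have excess at most 1, hence neither
    is negative.\<close>
  have C: "C x = x \<or> C x = Suc x" if x: "x < l" for x
  proof -
    have "C (l - 1) = l"
      using lt' unfolding C_def l_def by (subst filter_True) (force simp: l_def)+
    moreover have "take (l - 1) V = V" by (simp add: V_def)
    ultimately have "excess V = 1" using ex_take[of "l - 1"] l by simp
    then have "excess (take x V) + excess (drop x V) = 1"
      by (metis append_take_drop_id excess_append)
    moreover have "excess (take x V) \<le> 1" "excess (drop x V) \<le> 1"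
      using factor[of "[]" "take x V" "drop x V"] factor[of "take x V" "drop x V" "[]"] by simp_all
    ultimately show ?thesis using ex_take[OF x] by linarith
  qed
  define w where "w = tl (qdv_of_partition (l + 1) \<sigma>)"
  have len: "length w = l" by (simp add: w_def)
  have w01: "w ! i \<in> {0, 1}" if i: "i < l" for i
  proof -
    define p where "p = part \<sigma> (l - i)"
    have p0: "0 < p" using i part_pos[OF part, of "l - i"] by (simp add: p_def l_def)
    have "p \<in> set \<sigma>" using i by (auto simp: p_def part_def l_def)
    then have "p < l" by (rule lt')
    \<comment> \<open>With \<open>C (p - 1) \<le> i < C p\<close> these bounds give
      \<open>p - 1 \<le> i \<le> p\<close>, which says that \<open>w ! i\<close> is 0 or 1.\<close>
    then have "C p \<le> Suc p" "p - 1 \<le> C (p - 1)" using C[of p] C[of "p - 1"] by linarith+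
    moreover have "i < C p" "C (p - 1) \<le> i"
      using length_filter_le_part[OF part, of i] i by (simp_all add: C_def p_def l_def)
    moreover have "w ! i = int i + 1 - int p"
      using tl_qdv(1)[OF part] i by (simp add: w_def p_def l_def)
    ultimately show ?thesis using p0 by auto
  qed
  have "w \<noteq> []" using len l by auto
  then have "hd w = 0"
    using w01[of 0] l tl_qdv(2)[OF part, rule_format, of 0] len
    by (auto simp: w_def l_def hd_conv_nth)
  moreover have "last w = 1"
    using last_tl_qdv[OF False] lt w01[of "l - 1"] l len \<open>w \<noteq> []\<close>
    by (auto simp: w_def l_def last_conv_nth)
  moreover have "set w \<subseteq> {0, 1}" using w01 len by (metis in_set_conv_nth subsetI)
  ultimately show ?thesis by (simp add: binary_word_def w_def l_def)
qed

section \<open>Decoding binary words\<close>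

text \<open>The inverse of \<open>B\<close> up to reversal; \<open>c\<close> is the number of zeros
  already read.\<close>

fun zeros_before :: "nat \<Rightarrow> int list \<Rightarrow> nat list" where
  "zeros_before c [] = []"
| "zeros_before c (x # w) = (if x = 0 then zeros_before (Suc c) w else c # zeros_before c w)"

text \<open>The free starting index makes suffixes of \<open>B \<mu>\<close> words of the same
  form.\<close>

definition blocks :: "(nat \<Rightarrow> nat) \<Rightarrow> nat \<Rightarrow> nat \<Rightarrow> int list" where
  "blocks f c r = concat (map (\<lambda>i. 0 # replicate (f i) 1) [c..<r])"

lemma B_eq: "B \<mu> = blocks (count_list \<mu>) 1 (Suc (part \<mu> 1))"
  by (simp add: B_def blocks_def)

lemma blocks_Cons: "c < r \<Longrightarrow> blocks f c r = 0 # replicate (f c) 1 @ blocks f (Suc c) r"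
  by (simp add: blocks_def upt_conv_Cons)

lemma blocks_Nil: "r \<le> c \<Longrightarrow> blocks f c r = []"
  by (simp add: blocks_def)

lemma blocks_cong: "(\<And>i. c \<le> i \<Longrightarrow> i < r \<Longrightarrow> f i = g i) \<Longrightarrow> blocks f c r = blocks g c r"
  unfolding blocks_def by (rule arg_cong[of _ _ concat]) (auto intro: map_cong)

lemma set_blocks: "set (blocks f c r) \<subseteq> {0, 1}"
  by (auto simp: blocks_def)

lemma count_list_replicate: "count_list (replicate n x) y = (if x = y then n else 0)"
  by (induction n) auto

lemma zeros_before_append:
  "zeros_before c (v @ w) = zeros_before c v @ zeros_before (c + count_list v 0) w"
  by (induction v arbitrary: c) auto

lemma zeros_before_replicate_1 [simp]: "zeros_before c (replicate n 1) = replicate n c"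
  by (induction n) auto

lemma zeros_before_bounds: "x \<in> set (zeros_before c w) \<Longrightarrow> c \<le> x \<and> x \<le> c + count_list w 0"
  by (induction w arbitrary: c) (fastforce split: if_splits)+

lemma sorted_zeros_before: "sorted (zeros_before c w)"
  by (induction w arbitrary: c) (auto dest: zeros_before_bounds)

text \<open>The 0 opening block \<open>i\<close> raises the counter from \<open>i - 1\<close> to
  \<open>i\<close>, so each 1 of that block is recorded as \<open>i\<close>.\<close>

lemma count_zeros_before_blocks:
  "c \<le> Suc r \<Longrightarrow> count_list (zeros_before c (blocks f (Suc c) r)) i = (if c < i \<and> i < r then f i else 0)"
proof (induction "r - c" arbitrary: c)
  case 0
  then show ?case by (simp add: blocks_Nil)
next
  case (Suc d)
  show ?case
  proof (cases "Suc c < r")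
    case True
    then have "count_list (zeros_before c (blocks f (Suc c) r)) i =
      count_list (replicate (f (Suc c)) (Suc c)) i + count_list (zeros_before (Suc c) (blocks f (Suc (Suc c)) r)) i"
      by (simp add: blocks_Cons zeros_before_append)
    then show ?thesis using Suc True by (auto simp: count_list_replicate)
  qed (auto simp: blocks_Nil)
qed

text \<open>The leading ones, recorded as \<open>c\<close>, are part of the statement because
  removing the first 0 of a word may expose ones.\<close>

lemma blocks_zeros_before:
  assumes "set w \<subseteq> {0, 1}"
  shows "w = replicate (count_list (zeros_before c w) c) 1 @
    blocks (count_list (zeros_before c w)) (Suc c) (Suc (c + count_list w 0))"
  using assms
proof (induction w arbitrary: c)
  case Nil
  show ?case by (simp add: blocks_Nil)
next
  case (Cons x w)
  show ?case
  proof (cases "x = 0")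
    case True
    have "count_list (zeros_before (Suc c) w) c = 0"
      using zeros_before_bounds[of c "Suc c" w] by (auto simp: count_list_0_iff)
    moreover have "w = replicate (count_list (zeros_before (Suc c) w) (Suc c)) 1 @
      blocks (count_list (zeros_before (Suc c) w)) (Suc (Suc c)) (Suc (Suc c + count_list w 0))"
      by (rule Cons.IH) (use Cons.prems in simp)
    ultimately show ?thesis using True by (simp add: blocks_Cons)
  next
    case False
    then have x: "x = 1" using Cons.prems by simp
    have "w = replicate (count_list (zeros_before c w) c) 1 @
      blocks (count_list (zeros_before c w)) (Suc c) (Suc (c + count_list w 0))"
      by (rule Cons.IH) (use Cons.prems in simp)
    moreover have "blocks (count_list (zeros_before c (x # w))) (Suc c) r =
      blocks (count_list (zeros_before c w)) (Suc c) r" for r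
      by (rule blocks_cong) (simp add: x)
    moreover have "count_list (zeros_before c (x # w)) c = Suc (count_list (zeros_before c w) c)"
      "count_list (x # w) 0 = count_list w 0"
      by (simp_all add: x)
    ultimately show ?thesis by (simp only: x replicate_Suc append_Cons)
  qed
qed

lemma sorted_eqI_count:
  fixes xs ys :: "nat list"
  assumes "sorted xs" "sorted ys" "\<And>i. count_list xs i = count_list ys i"
  shows "xs = ys"
  using assms
proof (induction xs arbitrary: ys)
  case Nil
  then show ?case by (metis count_list.simps(1) count_list_0_iff list.set_intros(1) neq_Nil_conv)
next
  case (Cons x xs)
  have set: "set (x # xs) = set ys"
    using Cons.prems(3) by (metis (no_types) count_list_0_iff subsetI subset_antisym)
  then obtain y ys' where ys: "ys = y # ys'" by (cases ys) auto
  have "x \<le> y" "y \<le> x" using set Cons.prems(1,2) ys by auto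
  then have "x = y" by simp
  moreover have "xs = ys'"
    using Cons.prems ys \<open>x = y\<close> by (intro Cons.IH) (auto, metis add_right_cancel)
  ultimately show ?case using ys by simp
qed

lemma zeros_before_B:
  assumes "is_partition \<mu>"
  shows "zeros_before 0 (B \<mu>) = rev \<mu>"
proof (rule sorted_eqI_count)
  show "sorted (rev \<mu>)" using assms by (simp add: is_partition_def sorted_wrt_rev)
  fix i
  have "count_list \<mu> i = 0" if "i = 0 \<or> part \<mu> 1 < i"
    using that assms le_part_1[OF assms, of i] by (force simp: count_list_0_iff is_partition_def)
  then show "count_list (zeros_before 0 (B \<mu>)) i = count_list (rev \<mu>) i"
    using count_zeros_before_blocks[of 0 "Suc (part \<mu> 1)" "count_list \<mu>" i]
    by (auto simp: B_eq)
qed (rule sorted_zeros_before)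

lemma B_inj: "is_partition \<mu> \<Longrightarrow> is_partition \<nu> \<Longrightarrow> B \<mu> = B \<nu> \<Longrightarrow> \<mu> = \<nu>"
  by (metis zeros_before_B rev_rev_ident)

lemma binary_word_B:
  assumes "is_partition \<mu>"
  shows "binary_word (B \<mu>)"
proof (cases "\<mu> = []")
  case True
  then show ?thesis by (simp add: binary_word_def B_def part_def)
next
  case False
  define r where "r = hd \<mu>"
  have r: "0 < r" "r \<in> set \<mu>" using assms False by (cases \<mu>; simp add: r_def is_partition_Cons)+
  have pr: "part \<mu> 1 = r" using False unfolding part_1 r_def by simp
  have "blocks (count_list \<mu>) 1 (Suc r) = blocks (count_list \<mu>) 1 r @ 0 # replicate (count_list \<mu> r) 1"
    using r by (simp add: blocks_def)
  moreover have "count_list \<mu> r \<noteq> 0" using r by (simp add: count_list_0_iff)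
  ultimately have "last (B \<mu>) = 1" unfolding B_eq pr by simp
  moreover have "hd (B \<mu>) = 0" using r unfolding B_eq pr by (simp add: blocks_Cons)
  ultimately show ?thesis using set_blocks unfolding binary_word_def B_eq by blast
qed

lemma is_partition_zeros_before:
  assumes "binary_word w"
  shows "is_partition (rev (zeros_before 0 w))" "B (rev (zeros_before 0 w)) = w"
proof -
  let ?\<mu> = "rev (zeros_before 0 w)"
  have "0 \<notin> set (zeros_before 0 w)"
  proof (cases w)
    case (Cons x w')
    then have "x = 0" using assms by (simp add: binary_word_def)
    then show ?thesis using Cons zeros_before_bounds[of 0 "Suc 0" w'] by auto
  qed simp
  then show "is_partition ?\<mu>"
    by (simp add: is_partition_def sorted_wrt_rev sorted_zeros_before)
  \<comment> \<open>The final 1 has all zeros before it, so the largest part equals the number of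
    blocks.\<close>
  have "part ?\<mu> 1 = count_list w 0"
  proof (cases w rule: rev_cases)
    case Nil
    then show ?thesis by (simp add: part_def)
  next
    case (snoc w' x)
    then have "x = 1" using assms by (simp add: binary_word_def)
    then show ?thesis using snoc by (simp add: part_def zeros_before_append)
  qed
  moreover have "w = replicate (count_list (zeros_before 0 w) 0) 1 @
    blocks (count_list (zeros_before 0 w)) (Suc 0) (Suc (0 + count_list w 0))"
    using assms by (intro blocks_zeros_before) (simp add: binary_word_def)
  moreover have "count_list (zeros_before 0 w) 0 = 0"
    using \<open>0 \<notin> set (zeros_before 0 w)\<close> by (simp add: count_list_0_iff)
  moreover have "count_list ?\<mu> = count_list (zeros_before 0 w)" by (rule ext) simp
  ultimately show "B ?\<mu> = w" by (simp add: B_eq)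
qed

text \<open>By the recursion, appending 0 leaves the deficit unchanged, and appending 1 raises it by
  the number of zeros in \<open>w\<close>.\<close>

lemma defc_qdv_binary:
  "set w \<subseteq> {0, 1} \<Longrightarrow> defc_qdv (0 # w) = int (sum_list (zeros_before 0 w))"
proof (induction w rule: rev_induct)
  case Nil
  show ?case by (simp add: defc_qdv_0)
next
  case (snoc x w)
  have "length w = count_list w 0 + count_list w 1" "count_list w 2 = 0"
    using snoc.prems by (induction w) auto
  then show ?case
    using snoc defc_qdv_snoc[of "0 # w" x]
    by (auto simp: zeros_before_append ramp_pairs_def)
qed

section \<open>Binary words as starting points, and the initial partitions of the tails\<close>

lemma binary_word_partition:
  assumes "binary_word w"
  obtains \<gamma> where "chain_start \<gamma>" "length \<gamma> = length w" "qdv_of_partition (length \<gamma> + 1) \<gamma> = 0 # w"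
proof -
  define l where "l = length w"
  \<comment> \<open>This solves \<open>w ! i = i + 1 - f i\<close>, the formula for the QDV entries.
    A first entry 0 makes the smallest part positive, and a last entry 1 makes the largest part less
    than the length.\<close>
  define f where "f i = (if w ! i = 1 then i else Suc i)" for i
  define \<gamma> where "\<gamma> = rev (map f [0..<l])"
  have w01: "w ! i \<in> {0, 1}" if "i < l" for i
    using that assms by (auto simp: binary_word_def l_def dest!: nth_mem)
  have len: "length \<gamma> = l" by (simp add: \<gamma>_def)
  have f0: "f 0 = 1" if "0 < l"
    using that assms by (cases w) (auto simp: binary_word_def f_def l_def)
  have "sorted (map f [0..<l])"
    unfolding sorted_iff_nth_mono_less by (auto simp: f_def)
  moreover have "0 \<notin> set (map f [0..<l])"
  proof
    assume "0 \<in> set (map f [0..<l])"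
    then obtain i where i: "i < l" "f i = 0" by auto
    then have "i = 0" by (simp add: f_def split: if_splits)
    then show False using i f0 by simp
  qed
  ultimately have part: "is_partition \<gamma>"
    by (simp add: is_partition_def \<gamma>_def sorted_wrt_rev)
  have "chain_start \<gamma>"
  proof -
    have "hd \<gamma> < l" if "\<gamma> \<noteq> []"
    proof -
      have l: "0 < l" using that by (simp add: \<gamma>_def)
      then have "w ! (l - 1) = 1" using assms by (auto simp: binary_word_def l_def last_conv_nth)
      moreover have "hd \<gamma> = f (l - 1)" using l by (simp add: \<gamma>_def hd_rev last_map)
      ultimately show ?thesis using l by (simp add: f_def)
    qed
    then show ?thesis using part len by (simp add: chain_start_def)
  qed
  moreover have "tl (qdv_of_partition (length \<gamma> + 1) \<gamma>) = w"
  proof (rule nth_equalityI)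
    show "length (tl (qdv_of_partition (length \<gamma> + 1) \<gamma>)) = length w"
      by (simp add: len l_def)
    fix i assume "i < length (tl (qdv_of_partition (length \<gamma> + 1) \<gamma>))"
    then have i: "i < l" by (simp add: len)
    have "Suc 0 \<le> l - i" using i by linarith
    then have "part \<gamma> (l - i) = f i"
      using i len by (simp add: part_def \<gamma>_def rev_nth)
    then show "tl (qdv_of_partition (length \<gamma> + 1) \<gamma>) ! i = w ! i"
      using tl_qdv(1)[OF part] w01[OF i] i len by (auto simp: f_def)
  qed
  ultimately show ?thesis using that qdv_Cons_0[of \<gamma>] len by (simp add: l_def)
qed

lemma TI_props:
  assumes "is_partition \<mu>"
  shows "chain_start (TI \<mu>)" "qdv_of_partition (length (TI \<mu>) + 1) (TI \<mu>) = 0 # B \<mu>"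
proof -
  obtain \<gamma> where \<gamma>: "chain_start \<gamma>" "qdv_of_partition (length \<gamma> + 1) \<gamma> = 0 # B \<mu>"
    using binary_word_partition[OF binary_word_B[OF assms]] by metis
  then have "TI \<mu> = \<gamma>"
    using partition_of_class_dyck_class[of \<gamma> "length \<gamma> + 1"] by (simp add: TI_def chain_start_def)
  with \<gamma> show "chain_start (TI \<mu>)" "qdv_of_partition (length (TI \<mu>) + 1) (TI \<mu>) = 0 # B \<mu>" by auto
qed

lemma TI_inj:
  assumes "is_partition \<mu>" "is_partition \<nu>" "TI \<mu> = TI \<nu>"
  shows "\<mu> = \<nu>"
  using B_inj[OF assms(1,2)] TI_props(2)[OF assms(1)] TI_props(2)[OF assms(2)] assms(3) by simp

lemma immortal_start_TI:
  assumes "chain_start \<sigma>" "immortal \<sigma>" "defc \<sigma> = int k"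
  obtains \<mu> where "is_partition \<mu>" "sum_list \<mu> = k" "TI \<mu> = \<sigma>"
proof -
  define w where "w = tl (qdv_of_partition (length \<sigma> + 1) \<sigma>)"
  have w: "binary_word w" unfolding w_def by (rule immortal_start_binary[OF assms(1,2)])
  have qdv: "qdv_of_partition (length \<sigma> + 1) \<sigma> = 0 # w" unfolding w_def by (rule qdv_Cons_0)
  define \<mu> where "\<mu> = rev (zeros_before 0 w)"
  have \<mu>: "is_partition \<mu>" "B \<mu> = w"
    using is_partition_zeros_before[OF w] by (simp_all add: \<mu>_def)
  have "is_partition \<sigma>" using assms(1) by (simp add: chain_start_def)
  then have "TI \<mu> = \<sigma>"
    using partition_of_class_dyck_class[of \<sigma> "length \<sigma> + 1"] qdv \<mu>(2) by (simp add: TI_def)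
  moreover have "int (sum_list \<mu>) = int k"
    using defc_qdv_binary[of w] w defc_qdv_of_partition[of \<sigma> "length \<sigma> + 1"] qdv assms(3)
    by (simp add: \<mu>_def binary_word_def)
  ultimately show ?thesis using that \<mu>(1) by simp
qed

theorem theorem2p21:
  "\<forall>k::nat. \<exists>d0::int. \<forall>d::int. d \<ge> d0 \<longrightarrow>
     (\<forall>\<gamma>. is_partition \<gamma> \<and> defc \<gamma> = int k \<and> dinv \<gamma> = d \<longrightarrow>
       (\<exists>!\<mu>. is_partition \<mu> \<and> sum_list \<mu> = k \<and> \<gamma> \<in> TAIL \<mu>))"
proof
  fix k :: nat
  \<comment> \<open>The finitely many partitions on finite chains of deficit \<open>k\<close>; the
    threshold lies above their dinv values.\<close>
  define F where "F = (\<Union>\<sigma>\<in>{\<sigma>. chain_start \<sigma> \<and> defc \<sigma> = int k \<and> \<not> immortal \<sigma>}. chain \<sigma>)"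
  have "finite {\<sigma>. chain_start \<sigma> \<and> defc \<sigma> = int k \<and> \<not> immortal \<sigma>}"
    by (rule finite_subset[OF _ finite_chain_starts[of k]]) auto
  then have fin: "finite F"
    unfolding F_def using finite_chain by (auto simp: immortal_def)
  \<comment> \<open>Inserting 0 keeps the maximum meaningful if \<open>F\<close> is empty.\<close>
  define d0 where "d0 = Max (insert 0 (dinv ` F)) + 1"
  have "\<exists>!\<mu>. is_partition \<mu> \<and> sum_list \<mu> = k \<and> \<gamma> \<in> TAIL \<mu>"
    if \<gamma>: "is_partition \<gamma>" "defc \<gamma> = int k" "d0 \<le> dinv \<gamma>" for \<gamma>
  proof -
    obtain \<sigma> where \<sigma>: "chain_start \<sigma>" "\<gamma> \<in> chain \<sigma>" using in_some_chain[OF \<gamma>(1)] by blast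
    have "\<gamma> \<notin> F"
    proof
      assume "\<gamma> \<in> F"
      then have "dinv \<gamma> \<le> Max (insert 0 (dinv ` F))" using fin by (intro Max_ge) auto
      then show False using \<gamma>(3) by (simp add: d0_def)
    qed
    moreover have defc: "defc \<sigma> = int k" using defc_chain[OF \<sigma>(2)] \<gamma>(2) by simp
    ultimately have "immortal \<sigma>" using \<sigma> by (auto simp: F_def)
    then obtain \<mu> where \<mu>: "is_partition \<mu>" "sum_list \<mu> = k" "TI \<mu> = \<sigma>"
      using immortal_start_TI \<sigma>(1) defc by blast
    show ?thesis
    proof (rule ex1I[of _ \<mu>])
      show "is_partition \<mu> \<and> sum_list \<mu> = k \<and> \<gamma> \<in> TAIL \<mu>"
        using \<mu> \<sigma>(2) by (simp add: TAIL_eq_chain)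
      fix \<nu> assume \<nu>: "is_partition \<nu> \<and> sum_list \<nu> = k \<and> \<gamma> \<in> TAIL \<nu>"
      then have "TI \<nu> = \<sigma>"
        using chain_start_unique[of \<gamma> "TI \<nu>" \<sigma>] TI_props(1)[of \<nu>] \<sigma> by (simp add: TAIL_eq_chain)
      then show "\<nu> = \<mu>" using TI_inj \<mu> \<nu> by simp
    qed
  qed
  then show "\<exists>d0. \<forall>d\<ge>d0. \<forall>\<gamma>. is_partition \<gamma> \<and> defc \<gamma> = int k \<and> dinv \<gamma> = d \<longrightarrow>
    (\<exists>!\<mu>. is_partition \<mu> \<and> sum_list \<mu> = k \<and> \<gamma> \<in> TAIL \<mu>)"
    by blast
qed

end
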